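(* Let $k\ge1$ be an integer. For every integer $n\ge0$, $$\mathcal{D}_k(n)=\frac{1}{(3k)!}\sum_{J\subseteq\{\alpha_k+1,\ldots,k\}}\ \sum_{(t_1,\ldots,t_{\beta_k})\in\mathbf{A}_k(m_J)} s_k(t_1,\ldots,t_{\beta_k})\prod_{\ell=1}^{3k}\left(\frac{n-\sum_{j=1}^{\beta_k}t_j\varphi_k(j)-m_J}{D[k]}+\ell\right),$$ where $m_J=\sum_{i\in J}(3i-1)$ and, for an integer $m$, $\mathbf{A}_k(m)$ is the set of integer tuples $(t_1,\ldots,t_{\beta_k})$ such that $0\le t_j\le\varepsilon_k(j)\left(\frac{D[k]}{\varphi_k(j)}-1\right)$ for all $1\le j\le\beta_k$ and $\sum_{j=1}^{\beta_k}t_j\varphi_k(j)\equiv n-m\pmod{D[k]}$.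
   Context: A plane partition diamond of length $k$ of $n$ is a sequence $(a_1,a_2,\ldots,a_{3k+1})$ of nonnegative integers with $a_1+\cdots+a_{3k+1}=n$ such that, for all $0\le i\le k-1$, $a_{3i+1}\ge a_{3i+2}$, $a_{3i+1}\ge a_{3i+3}$, $a_{3i+2}\ge a_{3i+4}$, $a_{3i+3}\ge a_{3i+4}$. $\mathcal{D}_k(n)$ denotes the number of plane partition diamonds of length $k$ of $n$. Notation: $\alpha_k=\lfloor\frac{k+1}{2}\rfloor$; $\beta_k=5\alpha_k-2$ if $k$ is odd and $\beta_k=5\alpha_k+1$ if $k$ is even; $\mathcal{B}_k=\{1,2,\ldots,\beta_k\}$; $\mathcal{A}_k=\{1\le j\le 3k+1 : j\not\equiv4\pmod6\}$; $D[k]=\operatorname{lcm}(\mathcal{A}_k)$. The map $\varphi_k:\mathcal{B}_k\to\mathcal{A}_k$, $\varphi_k(j)=j+\left\lceil\frac{j-3}{5}\right\rceil$, is a bijection with inverse $\varphi_k^{-1}(j)=j-\left\lceil\frac{j-3}{6}\right\rceil$. $\mathcal{B}'_k=\{j\in\mathcal{B}_k : j\equiv 2 \text{ or } 4\pmod5 \text{ and } j\le\varphi_k^{-1}(3\alpha_k-1)\}$. The function $\varepsilon_k:\mathcal{B}_k\to\{1,2\}$ is $\varepsilon_k(j)=2$ if $j\in\mathcal{B}'_k$ and $\varepsilon_k(j)=1$ otherwise. $$s_k(t_1,\ldots,t_{\beta_k})=\prod_{j\in\mathcal{B}'_k}\left(1+\min\left\{t_j,\ 2\left(\frac{D[k]}{\varphi_k(j)}-1\right)-t_j\right\}\right).$$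 The set $J=\emptyset$ is allowed, with $m_\emptyset=0$. *)

theory Defs
  imports Complex_Main "HOL-Library.FuncSet" "HOL-Number_Theory.Cong"
begin

text \<open>Finite sequences and tuples are extensional functions on their (1-based) index sets.\<close>

definition plane_partition_diamonds :: "nat \<Rightarrow> nat \<Rightarrow> (nat \<Rightarrow> nat) set" where
  "plane_partition_diamonds k n =
     {a \<in> {1..3*k+1} \<rightarrow>\<^sub>E (UNIV :: nat set).
        (\<Sum>i=1..3*k+1. a i) = n \<and>
        (\<forall>i<k. a (3*i+1) \<ge> a (3*i+2) \<and> a (3*i+1) \<ge> a (3*i+3) \<and>
               a (3*i+2) \<ge> a (3*i+4) \<and> a (3*i+3) \<ge> a (3*i+4))}"

lemma finite_plane_partition_diamonds: "finite (plane_partition_diamonds k n)"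
proof (rule finite_subset)
  show "plane_partition_diamonds k n \<subseteq> {1..3*k+1} \<rightarrow>\<^sub>E {..n}"
  proof
    fix a assume a: "a \<in> plane_partition_diamonds k n"
    then have "a i \<le> n" if "i \<in> {1..3*k+1}" for i
      using member_le_sum[OF that, of a] by (simp add: plane_partition_diamonds_def)
    with a show "a \<in> {1..3*k+1} \<rightarrow>\<^sub>E {..n}"
      by (auto simp: plane_partition_diamonds_def PiE_iff)
  qed
qed (simp add: finite_PiE)

definition num_diamonds :: "nat \<Rightarrow> nat \<Rightarrow> nat" where
  "num_diamonds k n = card (plane_partition_diamonds k n)"

definition alpha :: "nat \<Rightarrow> nat" where
  "alpha k = (k + 1) div 2"

definition beta :: "nat \<Rightarrow> nat" where
  "beta k = (if odd k then 5 * alpha k - 2 else 5 * alpha k + 1)"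

definition Bset :: "nat \<Rightarrow> int set" where
  "Bset k = {1..int (beta k)}"

definition Aset :: "nat \<Rightarrow> int set" where
  "Aset k = {j. 1 \<le> j \<and> j \<le> 3 * int k + 1 \<and> \<not> [j = 4] (mod 6)}"

definition DD :: "nat \<Rightarrow> int" where
  "DD k = Lcm (Aset k)"

text \<open>The formula for the map \<open>\<phi>\<^sub>k\<close> does not involve \<open>k\<close>; only its domain
  \<^term>\<open>Bset k\<close> and its codomain \<^term>\<open>Aset k\<close> do.\<close>

definition phi :: "int \<Rightarrow> int" where
  "phi j = j + \<lceil>(real_of_int j - 3) / 5\<rceil>"

definition phi_inv :: "nat \<Rightarrow> int \<Rightarrow> int" where
  "phi_inv k = inv_into (Bset k) phi"

lemma phi_eq_div: "phi j = j - (3 - j) div 5"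
  using ceiling_divide_eq_div[of "j - 3" 5, where ?'a = real] by (simp add: phi_def)

lemma phi_inv_formula_eq_div:
  "j - \<lceil>(real_of_int j - 3) / 6\<rceil> = j + (3 - j) div 6"
  using ceiling_divide_eq_div[of "j - 3" 6, where ?'a = real] by simp

lemma int_beta: "int (beta k) = 3 * int k + 1 - int (alpha k)"
  unfolding beta_def alpha_def by (cases "odd k") (auto elim!: oddE evenE)

lemma phi_bij_aux:
  assumes "j \<in> Bset k"
  shows "phi j \<in> Aset k" "phi j - \<lceil>(real_of_int (phi j) - 3) / 6\<rceil> = j"
proof -
  define q where "q = (3 - j) div 5"
  define r where "r = (3 - j) mod 5"
  have r: "0 \<le> r" "r < 5" by (simp_all add: r_def)
  have j: "j = 3 - 5 * q - r"
    using mult_div_mod_eq[of 5 "3 - j"] unfolding q_def r_def by linarith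
  have phi: "phi j = 3 - 6 * q - r"
    unfolding phi_eq_div q_def[symmetric] using j by linarith
  have j_bounds: "1 \<le> j" "j \<le> 3 * int k + 1 - int (alpha k)"
    using assms int_beta[of k] by (simp_all add: Bset_def)
  have alpha: "2 * int (alpha k) \<le> int k + 1" "int k \<le> 2 * int (alpha k)"
    by (simp_all add: alpha_def)
  have "phi j mod 6 = (3 - r) mod 6"
    using mod_mult_self2[of "3 - r" 6 "-q"] by (simp add: phi algebra_simps)
  moreover have "(3 - r) mod 6 \<noteq> 4"
  proof -
    have "r = 0 \<or> r = 1 \<or> r = 2 \<or> r = 3 \<or> r = 4" using r by linarith
    then show ?thesis by auto
  qed
  moreover have "1 \<le> phi j"
    unfolding phi using j_bounds r j by linarith
  moreover have "phi j \<le> 3 * int k + 1"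
  proof (cases "- q \<le> int (alpha k)")
    case True
    then show ?thesis unfolding phi using j_bounds j by linarith
  next
    case False
    then show ?thesis unfolding phi using j_bounds r alpha j by linarith
  qed
  ultimately show "phi j \<in> Aset k"
    by (simp add: Aset_def cong_def)
  have "(3 - phi j) div 6 = q"
    using r by (intro int_div_pos_eq[of _ _ _ r]) (simp_all add: phi)
  then show "phi j - \<lceil>(real_of_int (phi j) - 3) / 6\<rceil> = j"
    unfolding phi_inv_formula_eq_div using phi j by linarith
qed

lemma phi_inv_bij_aux:
  assumes "j \<in> Aset k"
  shows "j - \<lceil>(real_of_int j - 3) / 6\<rceil> \<in> Bset k"
        "phi (j - \<lceil>(real_of_int j - 3) / 6\<rceil>) = j"
proof -
  define q where "q = (3 - j) div 6"
  define r where "r = (3 - j) mod 6"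
  have j: "j = 3 - 6 * q - r"
    using mult_div_mod_eq[of 6 "3 - j"] unfolding q_def r_def by linarith
  have j_bounds: "1 \<le> j" "j \<le> 3 * int k + 1" "j mod 6 \<noteq> 4"
    using assms by (simp_all add: Aset_def cong_def)
  have "r \<noteq> 5"
  proof
    assume "r = 5"
    then have "j = 4 + 6 * (- q - 1)" using j by simp
    then show False using j_bounds(3) mod_mult_self2[of 4 6 "- q - 1"] by simp
  qed
  moreover have "0 \<le> r" "r < 6" by (simp_all add: r_def)
  ultimately have r: "0 \<le> r" "r < 5" by linarith+
  have alpha: "2 * int (alpha k) \<le> int k + 1" "int k \<le> 2 * int (alpha k)"
    by (simp_all add: alpha_def)
  have inv: "j - \<lceil>(real_of_int j - 3) / 6\<rceil> = 3 - 5 * q - r"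
    unfolding phi_inv_formula_eq_div q_def[symmetric] using j by linarith
  have "1 \<le> 3 - 5 * q - r"
    using j_bounds r j by linarith
  moreover have "3 - 5 * q - r \<le> 3 * int k + 1 - int (alpha k)"
  proof (cases "- q \<ge> int (alpha k)")
    case True
    then show ?thesis using j_bounds j by linarith
  next
    case False
    then show ?thesis using r alpha by linarith
  qed
  ultimately show "j - \<lceil>(real_of_int j - 3) / 6\<rceil> \<in> Bset k"
    by (simp add: inv Bset_def int_beta)
  have "(3 - (3 - 5 * q - r)) div 5 = q"
    using r by (intro int_div_pos_eq[of _ _ _ r]) simp_all
  then show "phi (j - \<lceil>(real_of_int j - 3) / 6\<rceil>) = j"
    unfolding inv phi_eq_div using j by linarith
qed

lemma bij_betw_phi: "bij_betw phi (Bset k) (Aset k)"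
  by (rule bij_betw_byWitness[where f' = "\<lambda>j. j - \<lceil>(real_of_int j - 3) / 6\<rceil>"])
     (use phi_bij_aux phi_inv_bij_aux in blast)+

lemma phi_inv_eq:
  assumes "j \<in> Aset k"
  shows "phi_inv k j = j - \<lceil>(real_of_int j - 3) / 6\<rceil>"
  unfolding phi_inv_def
  using phi_inv_bij_aux[OF assms] bij_betw_imp_inj_on[OF bij_betw_phi]
  by (intro inv_into_f_eq) auto

definition Bset' :: "nat \<Rightarrow> int set" where
  "Bset' k = {j \<in> Bset k. ([j = 2] (mod 5) \<or> [j = 4] (mod 5)) \<and>
                          j \<le> phi_inv k (3 * int (alpha k) - 1)}"

definition eps :: "nat \<Rightarrow> int \<Rightarrow> int" where
  "eps k j = (if j \<in> Bset' k then 2 else 1)"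

text \<open>For \<^term>\<open>j \<in> Bset k\<close> the number \<^term>\<open>phi j\<close> is in \<^term>\<open>Aset k\<close>, so it
  divides \<^term>\<open>DD k\<close> and the integer divisions below are exact.\<close>

lemma phi_dvd_DD: "j \<in> Bset k \<Longrightarrow> phi j dvd DD k"
  unfolding DD_def by (intro dvd_Lcm phi_bij_aux)

definition s :: "nat \<Rightarrow> (int \<Rightarrow> int) \<Rightarrow> int" where
  "s k t = (\<Prod>j\<in>Bset' k. 1 + min (t j) (2 * (DD k div phi j - 1) - t j))"

definition weighted_sum :: "nat \<Rightarrow> (int \<Rightarrow> int) \<Rightarrow> int" where
  "weighted_sum k t = (\<Sum>j\<in>Bset k. t j * phi j)"

text \<open>The set \<open>\<^bold>A\<^sub>k(m)\<close>; its implicit dependence on \<open>n\<close> is made explicit.\<close>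

definition tuples :: "nat \<Rightarrow> nat \<Rightarrow> int \<Rightarrow> (int \<Rightarrow> int) set" where
  "tuples k n m =
     {t \<in> (\<Pi>\<^sub>E j\<in>Bset k. {0..eps k j * (DD k div phi j - 1)}).
        [weighted_sum k t = int n - m] (mod DD k)}"

lemma finite_tuples: "finite (tuples k n m)"
  by (rule finite_subset[of _ "\<Pi>\<^sub>E j\<in>Bset k. {0..eps k j * (DD k div phi j - 1)}"])
     (auto simp: tuples_def Bset_def intro!: finite_PiE)

definition m_of :: "nat set \<Rightarrow> int" where
  "m_of J = (\<Sum>i\<in>J. 3 * int i - 1)"

end

theory Submission
  imports Defs "HOL-Computational_Algebra.Formal_Power_Series"
begin

text \<open>Removing the last diamond and sorting its two middle entries shows that the generating function
  of plane partition diamonds is the product of all \<open>1 + q^(3i-1)\<close>, \<open>i \<le> k\<close>, divided by the product of all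
  \<open>1 - q^j\<close>, \<open>j \<le> 3k+1\<close>. The factors \<open>1 - q^(6i-2) = (1 - q^(3i-1)) (1 + q^(3i-1))\<close> of the denominator
  cancel the numerator factors with \<open>i \<le> \<alpha>\<^sub>k\<close>; the factors with \<open>i > \<alpha>\<^sub>k\<close> expand to the sum over \<open>J\<close>.
  Every remaining \<open>1 - q^j\<close> divides \<open>1 - q^D\<close> with \<open>D = D[k]\<close>, so the fraction can be expanded to the
  denominator \<open>(1 - q^D)^(3k+1)\<close>. The weights \<open>s\<^sub>k\<close> are the coefficients of the squared geometric sums,
  and the product over \<open>l\<close> is the binomial coefficient in the expansion of \<open>1 / (1 - q^D)^(3k+1)\<close>. Terms
  of degree above \<open>n\<close> contribute \<open>0\<close> because that degree is less than \<open>(3k+1) D\<close>.\<close>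

unbundle fps_syntax

section \<open>Generating functions of weighted sets\<close>

text \<open>Since \<open>card\<close> of an infinite set is \<open>0\<close>, a coefficient is
  meaningful only when its fibre is finite; hence the finiteness hypotheses of the product
  rule.\<close>

definition weight_fps :: "'a set \<Rightarrow> ('a \<Rightarrow> nat) \<Rightarrow> real fps" where
  "weight_fps A w = Abs_fps (\<lambda>n. real (card {x \<in> A. w x = n}))"

lemma weight_fps_times:
  assumes A: "\<And>n. finite {x \<in> A. w x = n}" and B: "\<And>n. finite {y \<in> B. v y = n}"
  shows "weight_fps (A \<times> B) (\<lambda>(x, y). w x + v y) = weight_fps A w * weight_fps B v"
proof (rule fps_ext)
  fix n
  have "{p \<in> A \<times> B. (case p of (x, y) \<Rightarrow> w x + v y) = n} =
      (\<Union>i\<in>{0..n}. {x \<in> A. w x = i} \<times> {y \<in> B. v y = n - i})"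
    by auto
  also have "card \<dots> = (\<Sum>i=0..n. card ({x \<in> A. w x = i} \<times> {y \<in> B. v y = n - i}))"
    by (rule card_UN_disjoint) (use A B in auto)
  finally show "weight_fps (A \<times> B) (\<lambda>(x, y). w x + v y) $ n = (weight_fps A w * weight_fps B v) $ n"
    by (simp add: weight_fps_def fps_mult_nth card_cartesian_product)
qed

lemma weight_fps_bij:
  assumes "bij_betw f A B" "\<And>x. x \<in> A \<Longrightarrow> v (f x) = w x"
  shows "weight_fps A w = weight_fps B v"
proof (rule fps_ext)
  fix n
  have "bij_betw f {x \<in> A. w x = n} {y \<in> B. v y = n}"
    by (rule bij_betw_subset[OF assms(1)])
       (use assms bij_betw_imp_surj_on[OF assms(1)] in auto)
  then show "weight_fps A w $ n = weight_fps B v $ n"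
    by (simp add: weight_fps_def bij_betw_same_card)
qed

lemma finite_weight_times:
  assumes A: "\<And>n. finite {x \<in> A. w x = n}" and B: "\<And>n. finite {y \<in> B. v y = n}"
  shows "finite {p \<in> A \<times> B. (case p of (x, y) \<Rightarrow> w x + v y) = (n::nat)}"
proof (rule finite_subset)
  show "{p \<in> A \<times> B. (case p of (x, y) \<Rightarrow> w x + v y) = n} \<subseteq>
      (\<Union>i\<in>{0..n}. {x \<in> A. w x = i} \<times> {y \<in> B. v y = n - i})"
    by auto
qed (use A B in auto)

lemma finite_multiples_eq: "p > 0 \<Longrightarrow> finite {c \<in> UNIV. p * c = (n::nat)}"
  by (rule finite_subset[of _ "{..n}"]) auto

text \<open>The coefficients are the indicator of divisibility by \<open>p\<close>. For
  \<open>n \<ge> p\<close>, \<open>p dvd n\<close> iff \<open>p dvd n - p\<close>, so only the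
  constant term survives.\<close>

lemma weight_fps_multiples:
  assumes "p > 0"
  shows "weight_fps UNIV (\<lambda>c. p * c) * (1 - fps_X ^ p) = 1"
proof -
  have card: "card {c. p * c = n} = (if p dvd n then 1 else 0)" for n
  proof (cases "p dvd n")
    case True
    then have "{c. p * c = n} = {n div p}" using assms by auto
    then show ?thesis using True by simp
  next
    case False
    then have "{c. p * c = n} = {}" by auto
    then show ?thesis using False by simp
  qed
  show ?thesis
  proof (rule fps_ext)
    fix n
    show "(weight_fps UNIV (\<lambda>c. p * c) * (1 - fps_X ^ p)) $ n = 1 $ n"
      using assms
      by (auto simp: right_diff_distrib fps_X_power_mult_right_nth weight_fps_def card dvd_minus_self
          dest: dvd_imp_le)
  qed
qed

lemma weight_fps_bool:
  assumes "p > 0"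
  shows "weight_fps UNIV (\<lambda>b. if b then p else 0) = 1 + fps_X ^ p"
proof (rule fps_ext)
  fix n
  have "{b. (if b then p else 0) = n} = (if n = 0 then {False} else if n = p then {True} else {})"
    using assms by (auto split: if_splits)
  then show "weight_fps UNIV (\<lambda>b. if b then p else 0) $ n = (1 + fps_X ^ p) $ n"
    using assms by (simp add: weight_fps_def)
qed

section \<open>Recurrence and product formula for diamonds\<close>

definition diamonds :: "nat \<Rightarrow> (nat \<Rightarrow> nat) set" where
  "diamonds k =
     {a \<in> {1..3*k+1} \<rightarrow>\<^sub>E (UNIV :: nat set).
        (\<forall>i<k. a (3*i+1) \<ge> a (3*i+2) \<and> a (3*i+1) \<ge> a (3*i+3) \<and>
               a (3*i+2) \<ge> a (3*i+4) \<and> a (3*i+3) \<ge> a (3*i+4))}"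

lemma plane_partition_diamonds_eq:
  "plane_partition_diamonds k n = {a \<in> diamonds k. (\<Sum>i=1..3*k+1. a i) = n}"
  by (auto simp: plane_partition_diamonds_def diamonds_def)

text \<open>The hypothesis is the bare chain of inequalities because the lemma is applied to the
  first \<open>3*k+1\<close> entries of a member of \<open>diamonds (Suc k)\<close>, which is not
  itself in \<open>diamonds k\<close>.\<close>

lemma diamonds_last_le:
  fixes a :: "nat \<Rightarrow> nat"
  assumes "\<forall>i<k. a (3*i+1) \<ge> a (3*i+2) \<and> a (3*i+1) \<ge> a (3*i+3) \<and>
               a (3*i+2) \<ge> a (3*i+4) \<and> a (3*i+3) \<ge> a (3*i+4)"
    and "1 \<le> j" "j \<le> 3*k+1"
  shows "a (3*k+1) \<le> a j"
  using assms
proof (induction k)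
  case (Suc k)
  have le: "a (3*k+2) \<le> a (3*k+1)" "a (3*k+3) \<le> a (3*k+1)" "a (3*k+4) \<le> a (3*k+2)"
    "a (3*k+4) \<le> a (3*k+3)"
    using Suc.prems(1) by auto
  have eq: "3 * Suc k + 1 = 3 * k + 4" by simp
  consider "j \<le> 3*k+1" | "j = 3*k+2" | "j = 3*k+3" | "j = 3*k+4"
    using Suc.prems(3) eq by linarith
  then have "a (3*k+4) \<le> a j"
  proof cases
    case 1
    then have "a (3*k+1) \<le> a j" using Suc by auto
    then show ?thesis using le by linarith
  qed (use le in auto)
  then show ?case by (simp only: eq)
qed (simp add: le_antisym)

text \<open>The entries \<open>w \<le> m \<le> M\<close> of the last diamond are recorded by their differences. The flag \<open>b\<close> says
  that the first middle entry is the strictly smaller one; strictness forces the extra \<open>1\<close> in \<open>M\<close>,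
  which makes the map below a bijection and contributes the factor \<open>1 + q^(3k+2)\<close>.\<close>

definition extend_diamond :: "nat \<Rightarrow> (nat \<Rightarrow> nat) \<times> nat \<times> nat \<times> nat \<times> bool \<Rightarrow> nat \<Rightarrow> nat" where
  "extend_diamond k = (\<lambda>(a, c, d, w, b).
     let m = d + w; M = c + of_bool b + m in
     restrict (\<lambda>i. if i \<le> 3*k+1 then a i + M
                   else if i = 3*k+2 then (if b then m else M)
                   else if i = 3*k+3 then (if b then M else m) else w) {1..3*k+4})"

text \<open>On \<open>diamonds (Suc k)\<close> no subtraction truncates: both middle entries are at
  most every earlier entry and at least \<open>w\<close>, and \<open>y < z\<close> forces a gap of
  at least \<open>1\<close>.\<close>

definition remove_diamond :: "nat \<Rightarrow> (nat \<Rightarrow> nat) \<Rightarrow> (nat \<Rightarrow> nat) \<times> nat \<times> nat \<times> nat \<times> bool" where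
  "remove_diamond k a =
     (let y = a (3*k+2); z = a (3*k+3); w = a (3*k+4) in
      (restrict (\<lambda>i. a i - max y z) {1..3*k+1},
       max y z - min y z - of_bool (y < z), min y z - w, w, y < z))"

lemma sum_diamond_Suc:
  fixes f :: "nat \<Rightarrow> 'a :: comm_monoid_add"
  shows "(\<Sum>i=1..3*k+4. f i) = (\<Sum>i=1..3*k+1. f i) + f (3*k+2) + f (3*k+3) + f (3*k+4)"
proof -
  have "3*k+4 = Suc (Suc (Suc (3*k+1)))" "3*k+2 = Suc (3*k+1)" "3*k+3 = Suc (Suc (3*k+1))"
    by simp_all
  then show ?thesis by (simp only: sum.cl_ivl_Suc) (simp add: add.assoc)
qed

lemma bij_extend_diamond:
  "bij_betw (extend_diamond k) (diamonds k \<times> UNIV) (diamonds (Suc k))"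
proof (rule bij_betw_byWitness[where f' = "remove_diamond k"])
  show "\<forall>x\<in>diamonds k \<times> UNIV. remove_diamond k (extend_diamond k x) = x"
  proof
    fix x assume "x \<in> diamonds k \<times> (UNIV :: (nat \<times> nat \<times> nat \<times> bool) set)"
    then obtain a c d w b where x: "x = (a, c, d, w, b)" and a: "a \<in> diamonds k"
      by auto
    \<comment> \<open>\<open>restrict\<close> returns \<open>undefined\<close> off its index set, so
      \<open>a\<close> is recovered there because it is extensional.\<close>
    have "a i = undefined" if "\<not> (1 \<le> i \<and> i \<le> 3*k+1)" for i
      using a that by (auto simp: diamonds_def PiE_def extensional_def)
    then show "remove_diamond k (extend_diamond k x) = x"
      by (cases b) (auto simp: x remove_diamond_def extend_diamond_def Let_def restrict_def fun_eq_iff)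
  qed
next
  show "\<forall>a\<in>diamonds (Suc k). extend_diamond k (remove_diamond k a) = a"
  proof
    fix a assume a: "a \<in> diamonds (Suc k)"
    define y z w where "y = a (3*k+2)" "z = a (3*k+3)" "w = a (3*k+4)"
    note yzw = this
    have "a (3*k+1) \<le> a j" if "1 \<le> j" "j \<le> 3*k+1" for j
      by (rule diamonds_last_le) (use a that in \<open>auto simp: diamonds_def\<close>)
    moreover have le: "y \<le> a (3*k+1)" "z \<le> a (3*k+1)" "w \<le> y" "w \<le> z"
      using a by (auto simp: diamonds_def yzw)
    ultimately have ge: "max y z \<le> a j" if "1 \<le> j" "j \<le> 3*k+1" for j
      using that by (meson max.bounded_iff order_trans)
    have ext: "a i = undefined" if "\<not> (1 \<le> i \<and> i \<le> 3*k+4)" for i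
      using a that by (auto simp: diamonds_def PiE_def extensional_def)
    have m: "(min y z - w) + w = min y z" using le by simp
    have M: "(max y z - min y z - of_bool (y < z)) + of_bool (y < z) + min y z = max y z"
      by auto
    show "extend_diamond k (remove_diamond k a) = a"
    proof
      fix i
      consider "\<not> (1 \<le> i \<and> i \<le> 3*k+4)" | "1 \<le> i" "i \<le> 3*k+1" | "i = 3*k+2" | "i = 3*k+3" | "i = 3*k+4"
        by linarith
      then show "extend_diamond k (remove_diamond k a) i = a i"
        unfolding extend_diamond_def remove_diamond_def Let_def yzw[symmetric] prod.case m M
        by cases (use ext ge[of i] in \<open>auto simp: yzw\<close>)
    qed
  qed
next
  show "extend_diamond k ` (diamonds k \<times> UNIV) \<subseteq> diamonds (Suc k)"
  proof (clarify)
    fix a c d w b assume a: "a \<in> diamonds k"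
    let ?e = "extend_diamond k (a, c, d, w, b)"
    have e: "?e i = a i + (c + of_bool b + (d + w))" if "1 \<le> i" "i \<le> 3*k+1" for i
      using that by (simp add: extend_diamond_def Let_def)
    have e3: "?e (3*k+2) = (if b then d + w else c + of_bool b + (d + w))"
      "?e (3*k+3) = (if b then c + of_bool b + (d + w) else d + w)" "?e (3*k+4) = w"
      by (simp_all add: extend_diamond_def Let_def)
    have "?e \<in> {1..3*Suc k+1} \<rightarrow>\<^sub>E UNIV"
      by (auto simp: extend_diamond_def Let_def)
    moreover have "?e (3*i+1) \<ge> ?e (3*i+2) \<and> ?e (3*i+1) \<ge> ?e (3*i+3) \<and>
               ?e (3*i+2) \<ge> ?e (3*i+4) \<and> ?e (3*i+3) \<ge> ?e (3*i+4)" if "i < Suc k" for i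
    proof (cases "i = k")
      case True
      then show ?thesis using e[of "3*k+1"] e3 by simp
    next
      case False
      then have "i < k" using that by simp
      then show ?thesis using a e by (simp add: diamonds_def)
    qed
    ultimately show "?e \<in> diamonds (Suc k)"
      by (simp add: diamonds_def)
  qed
next
  show "remove_diamond k ` diamonds (Suc k) \<subseteq> diamonds k \<times> UNIV"
  proof (rule image_subsetI)
    fix a assume a: "a \<in> diamonds (Suc k)"
    define a' where "a' = restrict (\<lambda>i. a i - max (a (3*k+2)) (a (3*k+3))) {1..3*k+1}"
    have "\<forall>i<k. a' (3*i+1) \<ge> a' (3*i+2) \<and> a' (3*i+1) \<ge> a' (3*i+3) \<and>
               a' (3*i+2) \<ge> a' (3*i+4) \<and> a' (3*i+3) \<ge> a' (3*i+4)"
      using a unfolding a'_def by (auto simp: diamonds_def intro!: diff_le_mono)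
    then have "a' \<in> diamonds k"
      by (auto simp: diamonds_def a'_def)
    then show "remove_diamond k a \<in> diamonds k \<times> UNIV"
      by (simp add: remove_diamond_def Let_def a'_def)
  qed
qed

text \<open>\<open>c\<close> occurs in the \<open>3*k+1\<close> earlier entries and in the larger
  middle one, \<open>d\<close> also in the smaller middle one, and \<open>w\<close> in all
  \<open>3*k+4\<close> entries. The flag raises the same entries as \<open>c\<close>.\<close>

lemma weight_extend_diamond:
  "(\<Sum>i=1..3 * Suc k+1. extend_diamond k (a, c, d, w, b) i) =
     (\<Sum>i=1..3*k+1. a i) + ((3*k+2) * c + ((3*k+3) * d + ((3*k+4) * w + (if b then 3*k+2 else 0))))"
proof -
  let ?e = "extend_diamond k (a, c, d, w, b)"
  let ?M = "c + of_bool b + (d + w)"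
  have "(\<Sum>i=1..3*k+1. ?e i) = (\<Sum>i=1..3*k+1. a i + ?M)"
    by (rule sum.cong) (auto simp: extend_diamond_def Let_def)
  also have "\<dots> = (\<Sum>i=1..3*k+1. a i) + (3*k+1) * ?M"
    by (simp only: sum.distrib) (simp add: algebra_simps)
  finally have "(\<Sum>i=1..3*k+4. ?e i) = (\<Sum>i=1..3*k+1. a i) + (3*k+1) * ?M + ?M + (d + w) + w"
    unfolding sum_diamond_Suc by (simp add: extend_diamond_def Let_def)
  moreover have "3 * Suc k + 1 = 3*k+4" by simp
  ultimately show ?thesis
    by (simp only:) (simp add: algebra_simps)
qed

definition diamond_fps :: "nat \<Rightarrow> real fps" where
  "diamond_fps k = weight_fps (diamonds k) (\<lambda>a. \<Sum>i=1..3*k+1. a i)"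

lemma diamond_fps_nth: "diamond_fps k $ n = real (num_diamonds k n)"
  by (simp add: diamond_fps_def weight_fps_def num_diamonds_def plane_partition_diamonds_eq)

text \<open>The free parameters \<open>c\<close>, \<open>d\<close>, \<open>w\<close> give three
  geometric series and the flag gives the factor on the right. Denominators are multiplied out, so
  no inverse of a power series is needed.\<close>

lemma diamond_fps_Suc:
  "diamond_fps (Suc k) * ((1 - fps_X ^ (3*k+2)) * (1 - fps_X ^ (3*k+3)) * (1 - fps_X ^ (3*k+4))) =
   diamond_fps k * (1 + fps_X ^ (3*k+2))"
proof -
  let ?m = "\<lambda>p. weight_fps UNIV (\<lambda>c::nat. p * c)"
  have fin: "finite {a \<in> diamonds k. (\<Sum>i=1..3*k+1. a i) = n}" for n
    using finite_plane_partition_diamonds by (simp add: plane_partition_diamonds_eq)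
  have finb: "finite {b \<in> UNIV. (if b then 3*k+2 else 0) = n}" for n
    by simp
  note fm = finite_multiples_eq
  have pos: "3*k+2 > 0" "3*k+3 > 0" "3*k+4 > 0" by simp_all
  note f1 = finite_weight_times[OF fm[OF pos(3)] finb]
  note f2 = finite_weight_times[OF fm[OF pos(2)] f1]
  note f3 = finite_weight_times[OF fm[OF pos(1)] f2]
  note t = weight_fps_times[OF fm[OF pos(3)] finb]
     weight_fps_times[OF fm[OF pos(2)] f1] weight_fps_times[OF fm[OF pos(1)] f2]
     weight_fps_times[OF fin f3]
  have "diamond_fps (Suc k) = weight_fps (diamonds k \<times> (UNIV \<times> (UNIV \<times> (UNIV \<times> UNIV))))
     (\<lambda>(a, x). (\<Sum>i=1..3*k+1. a i) + (case x of (c, x) \<Rightarrow> (3*k+2) * c + (case x of (d, x) \<Rightarrow>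
       (3*k+3) * d + (case x of (w, b) \<Rightarrow> (3*k+4) * w + (if b then 3*k+2 else 0)))))"
    unfolding diamond_fps_def
    by (rule weight_fps_bij[OF bij_extend_diamond[of k, folded UNIV_Times_UNIV], symmetric])
       (clarify, simp only: prod.case weight_extend_diamond)
  also have "\<dots> = diamond_fps k * (?m (3*k+2) * (?m (3*k+3) * (?m (3*k+4) * (1 + fps_X ^ (3*k+2)))))"
    unfolding t diamond_fps_def by (subst weight_fps_bool) simp_all
  finally have "diamond_fps (Suc k) * ((1 - fps_X ^ (3*k+2)) * (1 - fps_X ^ (3*k+3)) * (1 - fps_X ^ (3*k+4))) =
    diamond_fps k * (1 + fps_X ^ (3*k+2)) * ((?m (3*k+2) * (1 - fps_X ^ (3*k+2))) *
     (?m (3*k+3) * (1 - fps_X ^ (3*k+3))) * (?m (3*k+4) * (1 - fps_X ^ (3*k+4))))"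
    by (simp only: mult.assoc mult.commute mult.left_commute)
  then show ?thesis
    by (simp only: weight_fps_multiples[OF pos(1)] weight_fps_multiples[OF pos(2)]
        weight_fps_multiples[OF pos(3)] mult_1_right)
qed

lemma diamond_fps_0: "diamond_fps 0 * (1 - fps_X) = 1"
proof -
  have "bij_betw (\<lambda>c. \<lambda>i\<in>{1..3*0+1}. c) UNIV (diamonds 0)"
    by (rule bij_betw_byWitness[where f' = "\<lambda>a. a 1"])
       (auto simp: diamonds_def PiE_def extensional_def fun_eq_iff)
  then have "diamond_fps 0 = weight_fps UNIV (\<lambda>c. 1 * c)"
    unfolding diamond_fps_def by (rule weight_fps_bij[symmetric]) simp
  then show ?thesis using weight_fps_multiples[of 1] by simp
qed

lemma diamond_fps_prod:
  "diamond_fps k * (\<Prod>j=1..3*k+1. 1 - fps_X ^ j) = (\<Prod>i=1..k. 1 + fps_X ^ (3*i-1))"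
proof (induction k)
  case 0
  show ?case using diamond_fps_0 by simp
next
  case (Suc k)
  have "3 * Suc k + 1 = Suc (Suc (Suc (3*k+1)))" "3*k+4 = Suc (Suc (Suc (3*k+1)))"
    "3*k+2 = Suc (3*k+1)" "3*k+3 = Suc (Suc (3*k+1))"
    by simp_all
  then have "(\<Prod>j=1..3 * Suc k+1. 1 - fps_X ^ j :: real fps) =
    (\<Prod>j=1..3*k+1. 1 - fps_X ^ j) * ((1 - fps_X ^ (3*k+2)) * (1 - fps_X ^ (3*k+3)) * (1 - fps_X ^ (3*k+4)))"
    by (simp only: prod.cl_ivl_Suc mult.assoc) simp
  then have "diamond_fps (Suc k) * (\<Prod>j=1..3 * Suc k+1. 1 - fps_X ^ j) =
     (diamond_fps (Suc k) * ((1 - fps_X ^ (3*k+2)) * (1 - fps_X ^ (3*k+3)) * (1 - fps_X ^ (3*k+4)))) *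
     (\<Prod>j=1..3*k+1. 1 - fps_X ^ j)"
    by (simp only: mult.assoc mult.commute mult.left_commute)
  also have "\<dots> = (diamond_fps k * (\<Prod>j=1..3*k+1. 1 - fps_X ^ j)) * (1 + fps_X ^ (3*k+2))"
    unfolding diamond_fps_Suc by (simp only: mult.assoc mult.commute mult.left_commute)
  also have "\<dots> = (\<Prod>i=1..Suc k. 1 + fps_X ^ (3*i-1))"
    unfolding Suc.IH by (simp del: power_Suc)
  finally show ?case .
qed

section \<open>Negative powers of \<open>1 - q^D\<close> and finite geometric sums\<close>

text \<open>This is the series of \<open>1 / (1 - q^D)^(N+1)\<close>, with an exponent one larger
  than \<open>N\<close>.\<close>

definition inverse_power_fps :: "nat \<Rightarrow> nat \<Rightarrow> real fps" where
  "inverse_power_fps D N =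
     Abs_fps (\<lambda>n. if D dvd n then real ((n div D + N) choose N) else 0)"

text \<open>Multiplying by \<open>1 - q^D\<close> takes differences along the multiples of
  \<open>D\<close>, which by Pascal's rule lowers \<open>N\<close> by one.\<close>

lemma inverse_power_fps_mult:
  assumes "D > 0"
  shows "inverse_power_fps D N * (1 - fps_X ^ D) ^ Suc N = 1"
proof (induction N)
  case 0
  show ?case
  proof (rule fps_ext)
    fix n
    show "(inverse_power_fps D 0 * (1 - fps_X ^ D) ^ Suc 0) $ n = 1 $ n"
      using assms
      by (auto simp: right_diff_distrib fps_X_power_mult_right_nth inverse_power_fps_def dvd_minus_self
          dest: dvd_imp_le)
  qed
next
  case (Suc N)
  have "inverse_power_fps D (Suc N) * (1 - fps_X ^ D) = inverse_power_fps D N"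
  proof (rule fps_ext)
    fix n
    show "(inverse_power_fps D (Suc N) * (1 - fps_X ^ D)) $ n = inverse_power_fps D N $ n"
    proof (cases "n < D")
      case True
      then show ?thesis
        using assms
        by (auto simp: right_diff_distrib fps_X_power_mult_right_nth inverse_power_fps_def
            dest: dvd_imp_le)
    next
      case False
      define m where "m = n - D"
      have n: "n = m + D" using False by (simp add: m_def)
      show ?thesis
        using assms
        by (simp add: right_diff_distrib fps_X_power_mult_right_nth inverse_power_fps_def n)
    qed
  qed
  then show ?case
    using Suc.IH by (simp add: mult.assoc[symmetric])
qed

lemma geometric_sum_mult:
  fixes x :: "'a :: comm_ring_1"
  shows "(1 - x) * (\<Sum>t\<in>{0..int m}. x ^ nat t) = 1 - x ^ Suc m"
proof -
  have "(\<Sum>t\<in>{0..int m}. x ^ nat t) = (\<Sum>t\<le>m. x ^ t)"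
    by (rule sum.reindex_bij_witness[of _ int nat]) auto
  then show ?thesis by (simp only: sum_gp_basic)
qed

text \<open>The sum is the square of \<open>1 + x + ... + x^m\<close>: the weight counts the ordered
  pairs of numbers up to \<open>m\<close> with sum \<open>t\<close>. The induction splits off a full
  geometric sum by separating the \<open>1\<close> in each weight.\<close>

lemma triangular_sum_mult_nat:
  fixes x :: "'a :: comm_ring_1"
  shows "(1 - x)^2 * (\<Sum>t\<le>2*m. of_nat (1 + min t (2*m - t)) * x ^ t) = (1 - x ^ Suc m)^2"
proof (induction m)
  case (Suc m)
  let ?g = "\<lambda>t. of_nat (min t (2*m + 2 - t)) * x ^ t"
  have "(\<Sum>t\<le>2 * Suc m. of_nat (1 + min t (2 * Suc m - t)) * x ^ t) =
      (\<Sum>t\<le>2*m+2. x ^ t) + (\<Sum>t\<le>2*m+2. ?g t)"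
    by (simp add: sum.distrib[symmetric] distrib_right del: sum.atMost_Suc)
  \<comment> \<open>\<open>?g\<close> vanishes at both ends \<open>0\<close> and
    \<open>2*m+2\<close>; dropping these and shifting the index leaves \<open>x\<close> times the
    sum for \<open>m\<close>.\<close>
  also have "(\<Sum>t\<le>2*m+2. ?g t) = (\<Sum>t\<le>Suc (2*m). ?g t)"
    by simp
  also have "\<dots> = (\<Sum>t\<le>2*m. ?g (Suc t))"
    by (simp only: sum.atMost_Suc_shift) simp
  also have "\<dots> = x * (\<Sum>t\<le>2*m. of_nat (1 + min t (2*m - t)) * x ^ t)"
    unfolding sum_distrib_left
    by (rule sum.cong) (auto simp: min_def algebra_simps)
  finally have "(1 - x)^2 * (\<Sum>t\<le>2 * Suc m. of_nat (1 + min t (2 * Suc m - t)) * x ^ t) =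
      (1 - x)^2 * ((\<Sum>t\<le>2*m+2. x ^ t) + x * (\<Sum>t\<le>2*m. of_nat (1 + min t (2*m - t)) * x ^ t))"
    by (rule arg_cong)
  also have "\<dots> = (1 - x) * ((1 - x) * (\<Sum>t\<le>2*m+2. x ^ t)) +
      x * ((1 - x)^2 * (\<Sum>t\<le>2*m. of_nat (1 + min t (2*m - t)) * x ^ t))"
    by (simp only: power2_eq_square distrib_left mult.assoc mult.left_commute)
  also have "\<dots> = (1 - x) * (1 - x ^ Suc (2*m+2)) + x * (1 - x ^ Suc m)^2"
    unfolding Suc.IH sum_gp_basic ..
  also have "\<dots> = (1 - x ^ Suc (Suc m))^2"
  proof -
    have "x ^ Suc (2*m+2) = x * x * x * x ^ m * x ^ m" "x ^ Suc (Suc m) = x * x * x ^ m" "x ^ Suc m = x * x ^ m"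
      by (simp_all add: mult_2 mult_2_right power_add ac_simps)
    then show ?thesis by (simp only: power2_eq_square) (simp add: algebra_simps)
  qed
  finally show ?case .
qed simp

lemma triangular_sum_mult:
  fixes x :: "'a :: comm_ring_1"
  shows "(1 - x)^2 * (\<Sum>t\<in>{0..2 * int m}. of_int (1 + min t (2 * int m - t)) * x ^ nat t) =
    (1 - x ^ Suc m)^2"
proof -
  have "(\<Sum>t\<in>{0..2 * int m}. of_int (1 + min t (2 * int m - t)) * x ^ nat t) =
     (\<Sum>t\<le>2*m. of_nat (1 + min t (2*m - t)) * x ^ t)"
  proof (rule sum.reindex_bij_witness[of _ int nat])
    fix t assume t: "t \<in> {0..2 * int m}"
    have "int (1 + min (nat t) (2*m - nat t)) = 1 + min t (2 * int m - t)"
      using t by auto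
    then show "of_nat (1 + min (nat t) (2*m - nat t)) * x ^ nat t =
        of_int (1 + min t (2 * int m - t)) * x ^ nat t"
      by (metis of_int_of_nat_eq)
  qed auto
  then show ?thesis using triangular_sum_mult_nat[of x m] by simp
qed

section \<open>Residues under \<open>phi\<close> and the doubled indices\<close>

lemma finite_Bset [simp]: "finite (Bset k)"
  by (simp add: Bset_def)

lemma finite_Aset [simp]: "finite (Aset k)"
  by (rule finite_subset[of _ "{1..3 * int k + 1}"]) (auto simp: Aset_def)

lemma Bset'_subset: "Bset' k \<subseteq> Bset k"
  by (auto simp: Bset'_def)

lemma phi_pos: "j \<in> Bset k \<Longrightarrow> phi j > 0"
  using phi_bij_aux(1)[of j k] by (simp add: Aset_def)

lemma DD_pos: "DD k > 0"
proof -
  have "0 \<notin> Aset k" by (simp add: Aset_def)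
  then have "DD k \<noteq> 0" by (simp add: DD_def Lcm_0_iff)
  moreover have "DD k \<ge> 0" unfolding DD_def by (rule Lcm_int_greater_eq_0)
  ultimately show ?thesis by linarith
qed

lemma DD_div_phi_ge_1:
  assumes "j \<in> Bset k"
  shows "DD k div phi j \<ge> 1"
proof -
  have "DD k div phi j > 0"
    using phi_pos[OF assms] DD_pos[of k] phi_dvd_DD[OF assms]
    by (simp add: pos_imp_zdiv_pos_iff zdvd_imp_le)
  then show ?thesis by linarith
qed

text \<open>Turns the bound in \<open>Bset'\<close>, expressed through \<open>phi_inv\<close>, into
  a bound on \<open>phi j\<close>.\<close>

lemma phi_strict_mono: "i < j \<Longrightarrow> phi i < phi j"
  unfolding phi_eq_div using zdiv_mono1[of "3 - j" "3 - i" 5] by linarith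

text \<open>A number congruent to 4 modulo 6 is 1 modulo 3, whereas \<open>3 * int i - 1\<close> is
  2 modulo 3.\<close>

lemma in_Aset_mod_3:
  assumes "1 \<le> i" "i \<le> k"
  shows "3 * int i - 1 \<in> Aset k"
proof -
  have "(3 * int i - 1) mod 6 \<noteq> 4"
  proof
    assume "(3 * int i - 1) mod 6 = 4"
    then obtain q where "3 * int i - 1 = 6 * q + 4"
      using mult_div_mod_eq[of 6 "3 * int i - 1"] by metis
    then show False by presburger
  qed
  then show ?thesis using assms by (simp add: Aset_def cong_def)
qed

text \<open>\<open>phi\<close> stretches blocks of five to blocks of six:
  \<open>j = 3 - 5 * q - r\<close> goes to \<open>3 - 6 * q - r\<close>. Both sides then say that
  \<open>r\<close> is \<open>1\<close> or \<open>4\<close>.\<close>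

lemma phi_mod_3: "[phi j = 2] (mod 3) \<longleftrightarrow> [j = 2] (mod 5) \<or> [j = 4] (mod 5)"
proof -
  define q r where "q = (3 - j) div 5" and "r = (3 - j) mod 5"
  have r: "0 \<le> r" "r < 5" by (simp_all add: r_def)
  have j: "j = 3 - r + 5 * (- q)"
    using mult_div_mod_eq[of 5 "3 - j"] unfolding q_def r_def by linarith
  have phi: "phi j = - r + 3 * (1 - 2 * q)"
    unfolding phi_eq_div q_def[symmetric] using j by (simp add: algebra_simps)
  have "phi j mod 3 = (- r) mod 3" unfolding phi by (rule mod_mult_self2)
  moreover have "j mod 5 = (3 - r) mod 5" by (subst j) (rule mod_mult_self2)
  moreover have "r = 0 \<or> r = 1 \<or> r = 2 \<or> r = 3 \<or> r = 4" using r by linarith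
  ultimately show ?thesis by (auto simp: cong_def)
qed

text \<open>The indices with \<open>eps k j = 2\<close> correspond exactly to the exponents
  \<open>3i-1\<close> that occur a second time when each \<open>1 - q^(6i-2)\<close> is
  factored.\<close>

lemma bij_betw_phi_Bset':
  "bij_betw phi (Bset' k) ((\<lambda>i. 3 * int i - 1) ` {1..alpha k})"
proof (rule bij_betw_subset[OF bij_betw_phi Bset'_subset])
  show "phi ` Bset' k = (\<lambda>i. 3 * int i - 1) ` {1..alpha k}"
  proof (cases "k = 0")
    case True
    \<comment> \<open>For \<open>k = 0\<close> the argument of \<open>phi_inv\<close> is
      \<open>-1\<close>, outside \<open>Aset 0\<close>, so its value is unspecified.
      \<open>Bset 0\<close> is just \<open>{1}\<close>, and the residue condition already excludes
      \<open>1\<close>.\<close>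
    have "[j = 2] (mod 5) \<or> [j = 4] (mod 5) \<Longrightarrow> j \<noteq> 1" for j :: int
      by (auto simp: cong_def)
    then show ?thesis using True by (auto simp: Bset'_def Bset_def alpha_def beta_def)
  next
    case False
    let ?b = "phi_inv k (3 * int (alpha k) - 1)"
    have alpha: "1 \<le> alpha k" "alpha k \<le> k" using False by (auto simp: alpha_def)
    have b: "phi ?b = 3 * int (alpha k) - 1" "?b \<in> Bset k"
      unfolding phi_inv_eq[OF in_Aset_mod_3[OF alpha]]
      by (rule phi_inv_bij_aux[OF in_Aset_mod_3[OF alpha]])+
    have le_iff: "j \<le> ?b \<longleftrightarrow> phi j \<le> 3 * int (alpha k) - 1" for j
      using phi_strict_mono[of j ?b] phi_strict_mono[of ?b j] b(1) by (cases j ?b rule: linorder_cases) auto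
    show ?thesis
    proof (intro equalityI subsetI)
      fix x assume "x \<in> phi ` Bset' k"
      then obtain j where j: "j \<in> Bset' k" and x: "x = phi j" by blast
      then have jB: "j \<in> Bset k" using Bset'_subset by blast
      have "[x = 2] (mod 3)" "x \<le> 3 * int (alpha k) - 1" "x > 0"
        using j jB phi_mod_3 le_iff phi_pos x by (auto simp: Bset'_def)
      moreover from this have "x = 3 * (x div 3) + 2"
        using mult_div_mod_eq[of 3 x] by (simp add: cong_def)
      ultimately have "x = 3 * int (nat (x div 3 + 1)) - 1" "nat (x div 3 + 1) \<in> {1..alpha k}"
        by auto
      then show "x \<in> (\<lambda>i. 3 * int i - 1) ` {1..alpha k}" by blast
    next
      fix x assume "x \<in> (\<lambda>i. 3 * int i - 1) ` {1..alpha k}"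
      then obtain i where i: "1 \<le> i" "i \<le> alpha k" and x: "x = 3 * int i - 1" by auto
      have "x \<in> phi ` Bset k"
        using in_Aset_mod_3[of i k] i alpha bij_betw_imp_surj_on[OF bij_betw_phi] x by auto
      then obtain j where j: "j \<in> Bset k" and xj: "x = phi j" by blast
      moreover have "[x = 2] (mod 3)"
      proof -
        have "x = 2 + 3 * (int i - 1)" using x by simp
        then show ?thesis by (simp only: cong_def mod_mult_self2)
      qed
      ultimately have "j \<in> Bset' k" using phi_mod_3[of j] le_iff x i by (auto simp: Bset'_def)
      then show "x \<in> phi ` Bset' k" using xj by blast
    qed
  qed
qed

lemma card_Bset': "card (Bset' k) = alpha k"
  using bij_betw_same_card[OF bij_betw_phi_Bset'] by (simp add: card_image inj_on_def)

text \<open>This total is the exponent of \<open>1 - q^D\<close> in the common denominator.\<close>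

lemma sum_eps: "(\<Sum>j\<in>Bset k. nat (eps k j)) = 3*k+1"
proof -
  have "(\<Sum>j\<in>Bset k. nat (eps k j)) = (\<Sum>j\<in>Bset k. 1 + (if j \<in> Bset' k then 1 else 0))"
    by (rule sum.cong) (auto simp: eps_def)
  also have "\<dots> = card (Bset k) + card (Bset' k)"
    by (simp only: sum.distrib) (simp add: sum.If_cases Int_absorb1[OF Bset'_subset])
  also have "\<dots> = beta k + alpha k" by (simp add: card_Bset' Bset_def)
  also have "\<dots> = 3*k+1" using int_beta[of k] by simp
  finally show ?thesis .
qed

section \<open>Regrouping the denominator and expanding the fraction\<close>

lemma prod_Bset_split:
  fixes F :: "int \<Rightarrow> 'a :: comm_monoid_mult"
  shows "(\<Prod>j\<in>Bset k. F (phi j) ^ nat (eps k j)) =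
    (\<Prod>j\<in>Aset k. F j) * (\<Prod>i=1..alpha k. F (3 * int i - 1))"
proof -
  have "(\<Prod>j\<in>Bset k. F (phi j) ^ nat (eps k j)) =
     (\<Prod>j\<in>Bset k. F (phi j) * (if j \<in> Bset' k then F (phi j) else 1))"
    by (rule prod.cong) (auto simp: eps_def power2_eq_square)
  also have "\<dots> = (\<Prod>j\<in>Bset k. F (phi j)) * (\<Prod>j\<in>Bset' k. F (phi j))"
    by (simp add: prod.distrib prod.If_cases Int_absorb1[OF Bset'_subset])
  also have "(\<Prod>j\<in>Bset k. F (phi j)) = (\<Prod>j\<in>Aset k. F j)"
    by (rule prod.reindex_bij_betw[OF bij_betw_phi])
  also have "(\<Prod>j\<in>Bset' k. F (phi j)) = (\<Prod>i=1..alpha k. F (3 * int i - 1))"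
    unfolding prod.reindex_bij_betw[OF bij_betw_phi_Bset'] by (subst prod.reindex) (auto simp: inj_on_def)
  finally show ?thesis .
qed

text \<open>The numbers removed from \<open>{1..3*k+1}\<close> to form \<open>Aset k\<close> are the
  \<open>6*i-2\<close>, and \<open>6*i-2 \<le> 3*k+1\<close> amounts to
  \<open>i \<le> alpha k\<close>.\<close>

lemma prod_Aset_split:
  fixes F :: "nat \<Rightarrow> 'a :: comm_monoid_mult"
  shows "(\<Prod>j=1..3*k+1. F j) = (\<Prod>j\<in>Aset k. F (nat j)) * (\<Prod>i=1..alpha k. F (6*i-2))"
proof -
  have un: "{1..3*k+1} = nat ` Aset k \<union> (\<lambda>i. 6*i-2) ` {1..alpha k}"
  proof (intro equalityI subsetI)
    fix j assume j: "j \<in> {1..3*k+1}"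
    show "j \<in> nat ` Aset k \<union> (\<lambda>i. 6*i-2) ` {1..alpha k}"
    proof (cases "j mod 6 = 4")
      case True
      then have "j = 6 * (j div 6) + 4" using mult_div_mod_eq[of 6 j] by simp
      moreover from this have "2 * (j div 6 + 1) \<le> k + 1" using j by simp
      ultimately have "j = 6 * (j div 6 + 1) - 2" "j div 6 + 1 \<in> {1..alpha k}"
        by (auto simp: alpha_def)
      then show ?thesis by blast
    next
      case False
      then have "int j mod 6 \<noteq> 4" using of_nat_mod[of j 6, where ?'a = int] by simp
      then have "int j \<in> Aset k" using j by (simp add: Aset_def cong_def)
      then show ?thesis by force
    qed
  next
    fix j assume "j \<in> nat ` Aset k \<union> (\<lambda>i. 6*i-2) ` {1..alpha k}"
    then show "j \<in> {1..3*k+1}" by (auto simp: Aset_def alpha_def)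
  qed
  have disj: "nat ` Aset k \<inter> (\<lambda>i. 6*i-2) ` {1..alpha k} = {}"
  proof -
    have "6*i-2 \<noteq> nat j" if "j \<in> Aset k" "i \<ge> 1" for i j
    proof
      assume "6*i-2 = nat j"
      then have "j = 4 + 6 * (int i - 1)" using that by (auto simp: Aset_def)
      then have "j mod 6 = 4" by (simp only: mod_mult_self2) simp
      then show False using that(1) by (simp add: Aset_def cong_def)
    qed
    then show ?thesis by fastforce
  qed
  have "inj_on nat (Aset k)" "inj_on (\<lambda>i. 6*i-2 :: nat) {1..alpha k}"
    by (auto simp: inj_on_def Aset_def)
  then show ?thesis
    unfolding un using disj by (simp add: prod.union_disjoint prod.reindex)
qed

text \<open>Coefficients and exponents of the sum that expands \<open>1 / (1 - q^\<phi>(j))^\<epsilon>(j)\<close> to the denominator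
  \<open>(1 - q^D)^\<epsilon>(j)\<close>.\<close>

definition factor_coeff :: "nat \<Rightarrow> int \<Rightarrow> int \<Rightarrow> int" where
  "factor_coeff k j t = (if j \<in> Bset' k then 1 + min t (2 * (DD k div phi j - 1) - t) else 1)"

definition factor_range :: "nat \<Rightarrow> int \<Rightarrow> int set" where
  "factor_range k j = {0..eps k j * (DD k div phi j - 1)}"

text \<open>With \<open>x = q^(phi j)\<close> and \<open>m + 1 = DD k div phi j\<close>, exactness
  of the division gives \<open>x^(m+1) = q^D\<close>. The geometric identity then covers
  \<open>eps k j = 1\<close> and the triangular one \<open>eps k j = 2\<close>.\<close>

lemma factor_expansion:
  assumes j: "j \<in> Bset k"
  shows "(1 - fps_X ^ nat (phi j)) ^ nat (eps k j) *
      (\<Sum>t\<in>factor_range k j. of_int (factor_coeff k j t) * fps_X ^ nat (t * phi j)) =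
    ((1 - fps_X ^ nat (DD k)) ^ nat (eps k j) :: real fps)"
proof -
  define m where "m = nat (DD k div phi j - 1)"
  let ?x = "fps_X ^ nat (phi j) :: real fps"
  have m: "DD k div phi j - 1 = int m"
    using DD_div_phi_ge_1[OF j] by (simp add: m_def)
  have "DD k = phi j * int (Suc m)"
    using phi_dvd_DD[OF j] m by (simp add: dvd_mult_div_cancel flip: m)
  then have "nat (DD k) = nat (phi j) * Suc m"
    using phi_pos[OF j] by (simp add: nat_mult_distrib del: of_nat_Suc)
  then have D: "?x ^ Suc m = fps_X ^ nat (DD k)"
    by (simp only: power_mult)
  have pow: "fps_X ^ nat (t * phi j) = ?x ^ nat t" if "t \<in> factor_range k j" for t
    using that phi_pos[OF j]
    by (simp add: factor_range_def nat_mult_distrib mult.commute flip: power_mult)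
  have "(\<Sum>t\<in>factor_range k j. of_int (factor_coeff k j t) * fps_X ^ nat (t * phi j)) =
     (\<Sum>t\<in>factor_range k j. of_int (factor_coeff k j t) * ?x ^ nat t)"
    by (rule sum.cong) (auto simp: pow)
  then show ?thesis
    using geometric_sum_mult[of ?x m] triangular_sum_mult[of ?x m] D
    by (cases "j \<in> Bset' k") (simp_all add: factor_range_def factor_coeff_def eps_def m)
qed

lemma s_eq_prod: "s k t = (\<Prod>j\<in>Bset k. factor_coeff k j (t j))"
  unfolding s_def factor_coeff_def
  by (simp add: prod.If_cases Int_absorb1[OF Bset'_subset])

lemma prod_factor_sums:
  "(\<Prod>j\<in>Bset k. \<Sum>t\<in>factor_range k j. of_int (factor_coeff k j t) * fps_X ^ nat (t * phi j)) =
   (\<Sum>t\<in>PiE (Bset k) (factor_range k). of_int (s k t) * fps_X ^ nat (weighted_sum k t) :: real fps)"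
proof -
  have "(\<Prod>j\<in>Bset k. of_int (factor_coeff k j (t j)) * fps_X ^ nat (t j * phi j)) =
     (of_int (s k t) * fps_X ^ nat (weighted_sum k t) :: real fps)"
    if t: "t \<in> PiE (Bset k) (factor_range k)" for t
  proof -
    \<comment> \<open>Nonnegativity lets \<open>nat\<close> commute with the sum of
      exponents.\<close>
    have "t j * phi j \<ge> 0" if "j \<in> Bset k" for j
      using t that phi_pos[of j k] by (auto simp: PiE_iff factor_range_def)
    then have "int (\<Sum>j\<in>Bset k. nat (t j * phi j)) = weighted_sum k t"
      unfolding weighted_sum_def of_nat_sum by (intro sum.cong) simp_all
    then have "(\<Sum>j\<in>Bset k. nat (t j * phi j)) = nat (weighted_sum k t)"
      by (metis nat_int)
    then show ?thesis by (simp add: prod.distrib s_eq_prod flip: power_sum)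
  qed
  then show ?thesis
    by (subst prod_sum_PiE) (auto simp: factor_range_def intro!: sum.cong)
qed

lemma prod_one_plus_X_power:
  "(\<Prod>i\<in>{alpha k + 1..k}. 1 + fps_X ^ (3*i-1)) =
   (\<Sum>J\<in>Pow {alpha k + 1..k}. fps_X ^ nat (m_of J) :: real fps)"
proof -
  have "(\<Prod>i\<in>{alpha k + 1..k}. fps_X ^ (3*i-1) + 1) =
     (\<Sum>J\<in>Pow {alpha k + 1..k}. (\<Prod>i\<in>J. fps_X ^ (3*i-1)) :: real fps)"
    by (subst prod_add) simp_all
  also have "\<dots> = (\<Sum>J\<in>Pow {alpha k + 1..k}. fps_X ^ nat (m_of J))"
  proof (rule sum.cong)
    fix J assume J: "J \<in> Pow {alpha k + 1..k}"
    \<comment> \<open>Every \<open>i\<close> in \<open>J\<close> is positive, so the natural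
      subtraction is exact.\<close>
    have "int (\<Sum>i\<in>J. 3*i-1) = m_of J"
      unfolding m_of_def of_nat_sum by (rule sum.cong) (use J in \<open>auto simp: of_nat_diff\<close>)
    then have "(\<Sum>i\<in>J. 3*i-1) = nat (m_of J)" by (metis nat_int)
    then show "(\<Prod>i\<in>J. fps_X ^ (3*i-1)) = (fps_X ^ nat (m_of J) :: real fps)"
      by (simp flip: power_sum)
  qed simp
  finally show ?thesis by (simp add: add.commute)
qed

lemma diamond_fps_Bset:
  "diamond_fps k * (\<Prod>j\<in>Bset k. (1 - fps_X ^ nat (phi j)) ^ nat (eps k j)) =
   (\<Prod>i\<in>{alpha k + 1..k}. 1 + fps_X ^ (3*i-1))"
proof -
  let ?P = "\<lambda>A. \<Prod>i\<in>A. 1 + fps_X ^ (3*i-1) :: real fps"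
  let ?A = "\<Prod>j\<in>Aset k. 1 - fps_X ^ nat j :: real fps"
  \<comment> \<open>Power series over a field form an integral domain, so this factor can be
    cancelled at the end; its factors have constant term \<open>1\<close>.\<close>
  have ne: "?P {1..alpha k} \<noteq> 0"
  proof (subst prod_zero_iff, simp, safe)
    fix i assume "i \<in> {1..alpha k}" "1 + fps_X ^ (3*i-1) = (0 :: real fps)"
    then have "(1 + fps_X ^ (3*i-1) :: real fps) $ 0 = 0" "3*i-1 \<noteq> 0" by simp_all
    then show False by simp
  qed
  have "(\<Prod>i=1..alpha k. 1 - fps_X ^ (6*i-2)) =
      (\<Prod>i=1..alpha k. (1 - fps_X ^ nat (3 * int i - 1)) * (1 + fps_X ^ (3*i-1)) :: real fps)"
  proof (rule prod.cong)
    fix i assume "i \<in> {1..alpha k}"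
    then have "nat (3 * int i - 1) = 3*i-1" "6*i-2 = (3*i-1) + (3*i-1)" by auto
    then show "1 - fps_X ^ (6*i-2) =
        (1 - fps_X ^ nat (3 * int i - 1)) * (1 + fps_X ^ (3*i-1) :: real fps)"
      by (simp add: algebra_simps flip: power_add)
  qed simp
  then have "(\<Prod>j=1..3*k+1. 1 - fps_X ^ j) =
      (\<Prod>j\<in>Bset k. (1 - fps_X ^ nat (phi j)) ^ nat (eps k j)) * ?P {1..alpha k}"
    unfolding prod_Aset_split prod_Bset_split[of "\<lambda>j. 1 - fps_X ^ nat j"]
    by (simp add: prod.distrib mult.assoc)
  moreover have "{1..k} = {1..alpha k} \<union> {alpha k + 1..k}" by (auto simp: alpha_def)
  then have "?P {1..k} = ?P {1..alpha k} * ?P {alpha k + 1..k}"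
    by (simp add: prod.union_disjoint)
  ultimately have "?P {1..alpha k} * (diamond_fps k *
      (\<Prod>j\<in>Bset k. (1 - fps_X ^ nat (phi j)) ^ nat (eps k j))) =
      ?P {1..alpha k} * ?P {alpha k + 1..k}"
    using diamond_fps_prod[of k] by (simp only: ac_simps)
  then show ?thesis using ne by simp
qed

lemma diamond_fps_expansion:
  "diamond_fps k =
    (\<Sum>J\<in>Pow {alpha k + 1..k}. \<Sum>t\<in>PiE (Bset k) (factor_range k).
      of_int (s k t) * (fps_X ^ (nat (m_of J) + nat (weighted_sum k t)) * inverse_power_fps (nat (DD k)) (3*k)))"
proof -
  let ?q = "\<lambda>j. \<Sum>t\<in>factor_range k j. of_int (factor_coeff k j t) * fps_X ^ nat (t * phi j) :: real fps"
  let ?d = "\<lambda>j. (1 - fps_X ^ nat (phi j)) ^ nat (eps k j) :: real fps"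
  let ?D = "1 - fps_X ^ nat (DD k) :: real fps"
  have "(\<Prod>j\<in>Bset k. ?d j) * (\<Prod>j\<in>Bset k. ?q j) = (\<Prod>j\<in>Bset k. ?D ^ nat (eps k j))"
    unfolding prod.distrib[symmetric] by (rule prod.cong) (simp_all add: factor_expansion)
  also have "\<dots> = ?D ^ Suc (3*k)"
    by (simp add: sum_eps flip: power_sum)
  finally have "inverse_power_fps (nat (DD k)) (3*k) * ((\<Prod>j\<in>Bset k. ?d j) * (\<Prod>j\<in>Bset k. ?q j)) = 1"
    using inverse_power_fps_mult[of "nat (DD k)" "3*k"] DD_pos[of k] by simp
  \<comment> \<open>Multiplying by this form of \<open>1\<close> supplies the product of all
    \<open>?d j\<close>, which \<open>diamond_fps_Bset\<close> absorbs into the numerator.\<close>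
  then have "diamond_fps k = (diamond_fps k * (\<Prod>j\<in>Bset k. ?d j)) * (\<Prod>j\<in>Bset k. ?q j) *
      inverse_power_fps (nat (DD k)) (3*k)"
    by (simp add: mult.assoc mult.commute[of _ "inverse_power_fps _ _"])
  also have "\<dots> = (\<Sum>J\<in>Pow {alpha k + 1..k}. fps_X ^ nat (m_of J)) *
     (\<Sum>t\<in>PiE (Bset k) (factor_range k). of_int (s k t) * fps_X ^ nat (weighted_sum k t)) *
      inverse_power_fps (nat (DD k)) (3*k)"
    by (simp only: diamond_fps_Bset prod_factor_sums prod_one_plus_X_power)
  finally show ?thesis
    unfolding sum_product unfolding sum_distrib_right by (simp only: power_add mult.assoc mult.left_commute)
qed

section \<open>Degree bound and extraction of coefficients\<close>

text \<open>The maximal degree of a tuple falls short of \<open>(3*k+1) * DD k\<close> by at least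
  the sum of \<open>Aset k\<close>. That sum exceeds \<open>m_of J\<close>, a sum of distinct
  elements of \<open>Aset k\<close> other than \<open>1\<close>.\<close>

lemma total_weight_less:
  assumes J: "J \<subseteq> {alpha k + 1..k}" and t: "t \<in> PiE (Bset k) (factor_range k)"
  shows "m_of J + weighted_sum k t < int (3*k+1) * DD k"
proof -
  have "weighted_sum k t \<le> (\<Sum>j\<in>Bset k. eps k j * (DD k - phi j))"
    unfolding weighted_sum_def
  proof (rule sum_mono)
    fix j assume j: "j \<in> Bset k"
    have "t j * phi j \<le> eps k j * (DD k div phi j - 1) * phi j"
      using t j phi_pos[OF j] by (auto simp: PiE_iff factor_range_def)
    also have "\<dots> = eps k j * (DD k div phi j * phi j - phi j)"
      by (simp add: algebra_simps)
    finally show "t j * phi j \<le> eps k j * (DD k - phi j)"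
      using phi_dvd_DD[OF j] by simp
  qed
  \<comment> \<open>As \<open>eps k j \<ge> 1\<close>, at least one copy of \<open>phi j\<close> is
    subtracted, and one copy of each suffices.\<close>
  also have "\<dots> \<le> (\<Sum>j\<in>Bset k. eps k j * DD k - phi j)"
    by (rule sum_mono) (use phi_pos in \<open>force simp: eps_def algebra_simps\<close>)
  also have "\<dots> = (\<Sum>j\<in>Bset k. eps k j) * DD k - (\<Sum>j\<in>Bset k. phi j)"
    by (simp add: sum_subtractf sum_distrib_right)
  also have "(\<Sum>j\<in>Bset k. phi j) = (\<Sum>j\<in>Aset k. j)"
    by (rule sum.reindex_bij_betw[OF bij_betw_phi])
  also have "(\<Sum>j\<in>Bset k. eps k j) = int (\<Sum>j\<in>Bset k. nat (eps k j))"
    unfolding of_nat_sum by (rule sum.cong) (auto simp: eps_def)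
  finally have 1: "weighted_sum k t \<le> int (3*k+1) * DD k - (\<Sum>j\<in>Aset k. j)"
    unfolding sum_eps .
  \<comment> \<open>The extra element \<open>1\<close>, never of the form
    \<open>3 * int i - 1\<close>, makes the final inequality strict.\<close>
  have "m_of J + 1 = (\<Sum>j\<in>insert 1 ((\<lambda>i. 3 * int i - 1) ` J). j)"
  proof -
    have "finite J" using J by (rule finite_subset) simp
    moreover have "1 \<notin> (\<lambda>i. 3 * int i - 1) ` J" by (auto, presburger)
    ultimately show ?thesis
      by (simp add: m_of_def sum.reindex inj_on_def)
  qed
  also have "\<dots> \<le> (\<Sum>j\<in>Aset k. j)"
  proof (rule sum_mono2[OF finite_Aset])
    have "(1::int) \<in> Aset k" by (simp add: Aset_def cong_def)
    moreover have "3 * int i - 1 \<in> Aset k" if "i \<in> J" for i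
      by (rule in_Aset_mod_3) (use that J in auto)
    ultimately show "insert 1 ((\<lambda>i. 3 * int i - 1) ` J) \<subseteq> Aset k" by blast
  qed (simp add: Aset_def)
  finally show ?thesis using 1 by linarith
qed

lemma binomial_eq_prod:
  "real ((u + N) choose N) = 1 / fact N * (\<Prod>l=1..N. real u + real l)"
proof -
  have "fact (u + N) = fact u * (\<Prod>l=1..N. real u + real l)"
    by (induction N) (simp_all add: algebra_simps)
  then show ?thesis by (simp add: binomial_fact)
qed

text \<open>If \<open>v > n\<close>, then the bound on \<open>v\<close> gives \<open>-N \<le> (n - v) / D < 0\<close>, so one factor of the product is \<open>0\<close>.\<close>

lemma inverse_power_fps_shift_nth:
  assumes D: "D > 0" and v: "v < (N+1) * D"
  shows "(fps_X ^ v * inverse_power_fps D N) $ n =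
    (if [int v = int n] (mod int D)
     then 1 / fact N * (\<Prod>l=1..N. (real n - real v) / real D + real l) else 0)"
proof (cases "[int v = int n] (mod int D)")
  case True
  then have "int D dvd int n - int v"
    by (simp only: cong_iff_dvd_diff dvd_diff_commute)
  then obtain u where u: "int n - int v = int D * u" by (rule dvdE)
  have "real n - real v = real D * of_int u"
    using arg_cong[OF u, of real_of_int] by simp
  then have q: "(real n - real v) / real D = of_int u"
    using D by simp
  show ?thesis
  proof (cases "u \<ge> 0")
    case True
    define w where "w = nat u"
    have "u = int w" using True by (simp add: w_def)
    then have "int n = int (v + D * w)" using u by simp
    then have n: "n = v + D * w" by (simp only: of_nat_eq_iff)
    then show ?thesis
      using \<open>[int v = int n] (mod int D)\<close> D \<open>u = int w\<close> binomial_eq_prod[of w N]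
      unfolding q by (simp add: fps_X_power_mult_nth inverse_power_fps_def n)
  next
    case False
    then have "int D * u < 0" using D by (simp add: mult_pos_neg)
    then have "n < v" using u by linarith
    have "int D * (- u) < int D * (int N + 1)"
    proof -
      have "int v < int ((N+1) * D)" using v by (simp only: of_nat_less_iff)
      then have "int v < int D * (int N + 1)" by (simp add: algebra_simps)
      then show ?thesis using u by simp
    qed
    then have "- u < int N + 1" using D by (subst (asm) mult_less_cancel_left_pos) auto
    then have "nat (- u) \<in> {1..N}" using False by auto
    moreover have "of_int u + real (nat (- u)) = 0" using False by simp
    ultimately have "(\<Prod>l=1..N. of_int u + real l) = 0"
      by (intro prod_zero) auto
    then show ?thesis using \<open>n < v\<close> by (simp add: fps_X_power_mult_nth q)
  qed
next
  case False
  \<comment> \<open>For \<open>v > n\<close> the shift already gives coefficient \<open>0\<close>,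
    so only \<open>v \<le> n\<close>, where the subtraction is exact, needs the congruence.\<close>
  have "\<not> D dvd n - v" if "v \<le> n"
  proof
    assume "D dvd n - v"
    then have "int D dvd int (n - v)" by (simp only: of_nat_dvd_iff)
    then have "int D dvd int n - int v" by (simp only: of_nat_diff[OF that])
    then show False using False by (simp add: cong_iff_dvd_diff dvd_diff_commute)
  qed
  then show ?thesis
    using False by (simp add: fps_X_power_mult_nth inverse_power_fps_def)
qed

theorem theorem4p2:
  fixes k n :: nat
  assumes "k \<ge> 1"
  shows "real (num_diamonds k n) =
    1 / fact (3*k) *
    (\<Sum>J \<in> Pow {alpha k + 1..k}. \<Sum>t \<in> tuples k n (m_of J).
       real_of_int (s k t) *
       (\<Prod>l=1..3*k. real_of_int (int n - weighted_sum k t - m_of J) / real_of_int (DD k) + real l))"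
proof -
  let ?T = "PiE (Bset k) (factor_range k)"
  let ?f = "\<lambda>J t. 1 / fact (3*k) * (real_of_int (s k t) *
       (\<Prod>l=1..3*k. real_of_int (int n - weighted_sum k t - m_of J) / real_of_int (DD k) + real l))"
  have fin: "finite ?T" by (auto intro!: finite_PiE simp: factor_range_def)
  have tuples: "tuples k n m = {t \<in> ?T. [weighted_sum k t = int n - m] (mod DD k)}" for m
    by (simp add: tuples_def factor_range_def[abs_def])
  \<comment> \<open>The congruence that defines \<open>tuples\<close> appears as the support
    condition of the coefficient; the conditional is turned into a restricted summation range by
    \<open>sum.inter_filter\<close> below.\<close>
  have nth: "(of_int (s k t) * (fps_X ^ (nat (m_of J) + nat (weighted_sum k t)) *
      inverse_power_fps (nat (DD k)) (3*k))) $ n =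
      (if [weighted_sum k t = int n - m_of J] (mod DD k) then ?f J t else 0)"
    if J: "J \<in> Pow {alpha k + 1..k}" and t: "t \<in> ?T" for J t
  proof -
    let ?v = "nat (m_of J) + nat (weighted_sum k t)"
    have "m_of J \<ge> 0" unfolding m_of_def by (rule sum_nonneg) (use J in auto)
    moreover have "weighted_sum k t \<ge> 0" unfolding weighted_sum_def
      by (rule sum_nonneg)
         (use t phi_pos in \<open>force simp: PiE_iff factor_range_def intro!: mult_nonneg_nonneg\<close>)
    ultimately have v: "int ?v = m_of J + weighted_sum k t" by simp
    have D: "int (nat (DD k)) = DD k" "nat (DD k) > 0" using DD_pos[of k] by simp_all
    have "int ?v < int ((3*k+1) * nat (DD k))"
      using total_weight_less[OF _ t] J unfolding v of_nat_mult D(1) by blast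
    then have "?v < (3*k+1) * nat (DD k)" by (simp only: of_nat_less_iff)
    note coeff = inverse_power_fps_shift_nth[OF D(2) this, of n, unfolded D(1)]
    have c1: "[int ?v = int n] (mod DD k) \<longleftrightarrow> [weighted_sum k t = int n - m_of J] (mod DD k)"
      unfolding v by (simp add: cong_iff_dvd_diff algebra_simps)
    have c2: "real n - real ?v = real_of_int (int n - weighted_sum k t - m_of J)"
      using arg_cong[OF v, of real_of_int]
      by (simp only: of_int_of_nat_eq of_int_diff of_int_add)
    have c3: "real (nat (DD k)) = real_of_int (DD k)" using D by simp
    show ?thesis
      unfolding fps_of_int[symmetric] fps_mult_left_const_nth coeff c1 c2 c3 by simp
  qed
  have "real (num_diamonds k n) = (\<Sum>J\<in>Pow {alpha k + 1..k}. \<Sum>t\<in>?T.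
      if [weighted_sum k t = int n - m_of J] (mod DD k) then ?f J t else 0)"
    unfolding diamond_fps_nth[symmetric] diamond_fps_expansion fps_sum_nth
    by (intro sum.cong refl nth)
  also have "\<dots> = (\<Sum>J\<in>Pow {alpha k + 1..k}. \<Sum>t\<in>tuples k n (m_of J). ?f J t)"
    unfolding tuples sum.inter_filter[OF fin] ..
  finally show ?thesis by (simp only: sum_distrib_left)
qed

end
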